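(* Suppose that $X$ is a space that is not countably compact. If $d(X)$ is less than the first measurable cardinal, then $X^{2^{d(X)}}$ is $e$-separable.
   Context: All topological spaces are assumed to be $T_1$. A space $Z$ is $e$-separable if there is a sequence $(D_n)_{n\in\omega}$ of closed discrete subspaces of $Z$ such that $\bigcup_{n\in\omega}D_n$ is dense in $Z$. The density $d(Z)$ is the smallest cardinality of a dense subset of $Z$. A space is countably compact if every countable open cover has a finite subcover. Measurable cardinals are uncountable; if there is none, the condition "less than the first measurable cardinal" is regarded as satisfied. $X^{2^{d(X)}}$ is the product of $2^{d(X)}$ (cardinal exponentiation) many copies of $X$ with the Tychonoff product topology. *)

theory Defs
  imports "HOL-Analysis.Analysis"
begin

unbundle cardinal_syntax

definition dense_in :: "'a topology \<Rightarrow> 'a set \<Rightarrow> bool" where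
  "dense_in X D \<longleftrightarrow> D \<subseteq> topspace X \<and> X closure_of D = topspace X"

definition e_separable :: "'a topology \<Rightarrow> bool" where
  "e_separable X \<longleftrightarrow>
     (\<exists>D :: nat \<Rightarrow> 'a set.
        (\<forall>n. closedin X (D n) \<and> subtopology X (D n) = discrete_topology (D n)) \<and>
        dense_in X (\<Union>n. D n))"

(* The library constant countably_compact speaks about the type-class topology;
   this is the analogue for abstract topologies, in the style of compact_space. *)
definition countably_compact_space :: "'a topology \<Rightarrow> bool" where
  "countably_compact_space X \<longleftrightarrow>
     (\<forall>\<U>. countable \<U> \<and> (\<forall>U\<in>\<U>. openin X U) \<and> \<Union>\<U> = topspace X \<longrightarrow>
        (\<exists>\<F>. finite \<F> \<and> \<F> \<subseteq> \<U> \<and> \<Union>\<F> = topspace X))"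

(* Cardinals are represented by cardinal-order relations, so the density is the
   least cardinal |D| of a dense set D, which is determined up to =o. *)
definition top_density :: "'a topology \<Rightarrow> 'a rel" where
  "top_density X =
     |SOME D. dense_in X D \<and> (\<forall>E. dense_in X E \<longrightarrow> |D| \<le>o |E| )|"

lemma top_density_minimal:
  shows "\<exists>D. dense_in X D \<and> top_density X = |D|"
    and "dense_in X E \<Longrightarrow> top_density X \<le>o |E|"
proof -
  have "dense_in X (topspace X)"
    by (simp add: dense_in_def)
  then obtain r where r: "r \<in> card_of ` Collect (dense_in X)"
    and min: "\<And>s. (s, r) \<in> ordLess \<Longrightarrow> s \<notin> card_of ` Collect (dense_in X)"
    using wfE_min[OF wf_ordLess, of _ "card_of ` Collect (dense_in X)"]
    by (metis (no_types, lifting) imageI mem_Collect_eq)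
  from r obtain D where D: "dense_in X D" "r = |D|"
    by auto
  have "|D| \<le>o |E|" if "dense_in X E" for E
  proof (rule ccontr)
    assume "\<not> |D| \<le>o |E|"
    then have "|E| <o |D|"
      by (simp add: not_ordLeq_iff_ordLess card_of_Well_order)
    with min[of "|E|"] D that show False
      by blast
  qed
  with D have *: "\<exists>D. dense_in X D \<and> (\<forall>E. dense_in X E \<longrightarrow> |D| \<le>o |E| )"
    by blast
  show "\<exists>D. dense_in X D \<and> top_density X = |D|"
    and "dense_in X E \<Longrightarrow> top_density X \<le>o |E|"
    using someI_ex[OF *] by (auto simp: top_density_def)
qed

definition ultrafilter_on :: "'a set \<Rightarrow> 'a set set \<Rightarrow> bool" where
  "ultrafilter_on A U \<longleftrightarrow>
     U \<subseteq> Pow A \<and> A \<in> U \<and> {} \<notin> U \<and>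
     (\<forall>S\<in>U. \<forall>T. S \<subseteq> T \<and> T \<subseteq> A \<longrightarrow> T \<in> U) \<and>
     (\<forall>S\<in>U. \<forall>T\<in>U. S \<inter> T \<in> U) \<and>
     (\<forall>S. S \<subseteq> A \<longrightarrow> S \<in> U \<or> A - S \<in> U)"

(* kappa-completeness concerns intersections of nonempty families of fewer than kappa
   members; natLeq is the cardinal aleph-0. *)
definition measurable_cardinal :: "'a rel \<Rightarrow> bool" where
  "measurable_cardinal \<kappa> \<longleftrightarrow>
     Card_order \<kappa> \<and> natLeq <o \<kappa> \<and>
     (\<exists>U. ultrafilter_on (Field \<kappa>) U \<and>
          (\<forall>x\<in>Field \<kappa>. {x} \<notin> U) \<and>
          (\<forall>\<F>. \<F> \<subseteq> U \<and> \<F> \<noteq> {} \<and> |\<F>| <o \<kappa> \<longrightarrow> \<Inter>\<F> \<in> U))"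

(* It suffices to let kappa range over the cardinals on the type underlying r:
   a cardinal with no copy on that type is larger than every cardinal on it. *)
definition below_first_measurable :: "'a rel \<Rightarrow> bool" where
  "below_first_measurable r \<longleftrightarrow> (\<forall>\<kappa> :: 'a rel. measurable_cardinal \<kappa> \<longrightarrow> r <o \<kappa>)"

end

theory Submission
  imports Defs
begin

text \<open>
  Let \<open>D\<close> be dense in \<open>X\<close> with \<open>|D| = d(X)\<close>. As \<open>X\<close> is \<open>T\<^sub>1\<close> and not countably compact, it contains
  a closed discrete sequence \<open>a\<close>; as \<open>|D|\<close> lies below the first measurable cardinal, every
  countably complete ultrafilter on \<open>D\<close> is principal, so \<open>x \<mapsto> (a (f x))\<^sub>f\<close> maps \<open>D\<close> onto a closed
  discrete subset of \<open>X\<^bsup>F\<^esup>\<close>, where \<open>F\<close> is the set of all \<open>f : D \<rightarrow> \<nat>\<close>. Index the power by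
  \<open>\<nat> \<times> F\<close>. A dense set is given by step functions in the style of Hewitt, Marczewski and Pondiczery:
  a finite list in \<open>D\<close> separates finitely many members of \<open>F\<close>, and a finite table assigns values
  in \<open>D\<close> to the resulting patterns. For a fixed shape of this data and fixed \<open>n\<close>, use the step
  function on the blocks below \<open>n\<close> and record the data, one entry per block, by the closed
  discrete embedding on the blocks from \<open>n\<close> on. Each of these countably many families is closed
  discrete, and their union is dense.
\<close>

section \<open>Countably complete ultrafilters below the first measurable cardinal\<close>

text \<open>
  If \<open>U\<close> is nonprincipal, let \<open>B\<close> index a family of members of \<open>U\<close> of least size whose intersection
  is not in \<open>U\<close>. Pushing \<open>U\<close> forward along a map that sends each point outside the intersection to
  the index of a member omitting it shows that \<open>|B|\<close> is measurable.
\<close>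
lemma countably_complete_ultrafilter_principal:
  fixes D :: "'a set"
  assumes below: "below_first_measurable |D|"
    and uf: "ultrafilter_on D U"
    and complete: "\<And>A :: nat \<Rightarrow> 'a set. (\<And>n. A n \<in> U) \<Longrightarrow> (\<Inter>n. A n) \<in> U"
  shows "\<exists>x\<in>D. {x} \<in> U"
proof (rule ccontr)
  assume nonprincipal: "\<not> (\<exists>x\<in>D. {x} \<in> U)"
  have sub: "U \<subseteq> Pow D" and top: "D \<in> U" and empty: "{} \<notin> U"
    and up: "\<And>S T. S \<in> U \<Longrightarrow> S \<subseteq> T \<Longrightarrow> T \<subseteq> D \<Longrightarrow> T \<in> U"
    and int: "\<And>S T. S \<in> U \<Longrightarrow> T \<in> U \<Longrightarrow> S \<inter> T \<in> U"
    and ultra: "\<And>S. S \<subseteq> D \<Longrightarrow> S \<in> U \<or> D - S \<in> U"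
    using uf unfolding ultrafilter_on_def by blast+
  \<comment> \<open>Index sets are taken inside \<open>D\<close> so that \<open>|B|\<close> lives on
    the type of \<open>|D|\<close>, where \<open>below_first_measurable\<close> applies, and so that
    \<open>|B|\<close> cannot exceed \<open>|D|\<close> in the end.\<close>
  define bad where "bad B \<longleftrightarrow> B \<subseteq> D \<and> B \<noteq> {} \<and> (\<exists>A. (\<forall>b\<in>B. A b \<in> U) \<and> (\<Inter>b\<in>B. A b) \<notin> U)" for B
  have "D \<noteq> {}"
    using top empty by auto
  \<comment> \<open>The complements of points witness that \<open>D\<close> itself is bad, so a bad
    set of least cardinality exists.\<close>
  have "D - {x} \<in> U" if "x \<in> D" for x
    using ultra[of "{x}"] nonprincipal that by auto
  moreover have "(\<Inter>b\<in>D. D - {b}) = {}"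
    using \<open>D \<noteq> {}\<close> by blast
  ultimately have "bad D"
    unfolding bad_def using \<open>D \<noteq> {}\<close> empty by (metis subset_refl)
  then obtain r where "r \<in> card_of ` Collect bad"
    and rmin: "\<And>s. (s, r) \<in> ordLess \<Longrightarrow> s \<notin> card_of ` Collect bad"
    using wfE_min[OF wf_ordLess, of _ "card_of ` Collect bad"]
    by (metis (no_types, lifting) imageI mem_Collect_eq)
  then obtain B where B: "bad B" and r: "r = |B|"
    by auto
  have minimal: "(\<Inter>c\<in>C. P c) \<in> U"
    if "|C| <o |B|" "C \<subseteq> D" "C \<noteq> {}" "\<And>c. c \<in> C \<Longrightarrow> P c \<in> U" for C P
  proof (rule ccontr)
    assume "(\<Inter>c\<in>C. P c) \<notin> U"
    then have "bad C"
      unfolding bad_def using that by (intro conjI exI[of _ P]) auto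
    then show False
      using rmin that(1) r by blast
  qed
  obtain A where A: "\<And>b. b \<in> B \<Longrightarrow> A b \<in> U" "(\<Inter>b\<in>B. A b) \<notin> U" and BD: "B \<subseteq> D" "B \<noteq> {}"
    using B unfolding bad_def by blast
  have "\<not> countable B"
  proof
    assume "countable B"
    have "(\<Inter>n. A (from_nat_into B n)) \<in> U"
      by (rule complete) (simp add: A(1) BD(2) from_nat_into)
    moreover have "(\<Inter>n. A (from_nat_into B n)) = (\<Inter>b\<in>B. A b)"
      using range_from_nat_into[OF BD(2) \<open>countable B\<close>] by (metis image_image)
    ultimately show False
      using A(2) by simp
  qed
  have uncountable: "natLeq <o |B|"
  proof -
    have "\<not> |B| \<le>o natLeq"
    proof
      assume "|B| \<le>o natLeq"
      then have "|B| \<le>o |UNIV :: nat set|"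
        using card_of_nat ordIso_symmetric ordLeq_ordIso_trans by blast
      then show False
        using \<open>\<not> countable B\<close> unfolding card_of_ordLeq[symmetric] countable_def by auto
    qed
    then show ?thesis
      by (simp add: not_ordLeq_iff_ordLess card_of_Well_order natLeq_Well_order)
  qed
  define C where "C = D - (\<Inter>b\<in>B. A b)"
  have inter_sub: "(\<Inter>b\<in>B. A b) \<subseteq> D"
    using A(1) BD(2) sub by blast
  have CU: "C \<in> U"
    unfolding C_def using ultra[OF inter_sub] A(2) by blast
  obtain b0 where b0: "b0 \<in> B"
    using BD(2) by blast
  \<comment> \<open>The default \<open>b0\<close> outside \<open>C\<close> keeps \<open>h\<close>
    inside \<open>B\<close>, so that preimages commute with complements in \<open>B\<close>.\<close>
  define h where "h x = (if x \<in> C then SOME b. b \<in> B \<and> x \<notin> A b else b0)" for x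
  have hC: "h x \<in> B \<and> x \<notin> A (h x)" if "x \<in> C" for x
  proof -
    have "\<exists>b. b \<in> B \<and> x \<notin> A b"
      using that unfolding C_def by blast
    from someI_ex[OF this] show ?thesis
      using that by (simp add: h_def)
  qed
  have hB: "h x \<in> B" for x
    using hC[of x] b0 by (cases "x \<in> C") (auto simp: h_def)
  define V where "V = {S. S \<subseteq> B \<and> {x\<in>D. h x \<in> S} \<in> U}"
  have "measurable_cardinal |B|"
    unfolding measurable_cardinal_def Field_card_of
  proof (intro conjI exI[of _ V] ballI allI impI)
    show "card_order_on B |B|"
      by (rule card_of_card_order_on)
    show "natLeq <o |B|"
      by (rule uncountable)
    show "ultrafilter_on B V"
      unfolding ultrafilter_on_def
    proof (intro conjI ballI allI impI)
      show "V \<subseteq> Pow B"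
        unfolding V_def by blast
      show "B \<in> V"
        using top hB unfolding V_def by simp
      show "{} \<notin> V"
        using empty unfolding V_def by simp
    next
      fix S T assume "S \<in> V" "S \<subseteq> T \<and> T \<subseteq> B"
      then show "T \<in> V"
        unfolding V_def using up[of "{x\<in>D. h x \<in> S}" "{x\<in>D. h x \<in> T}"] by blast
    next
      fix S T assume "S \<in> V" "T \<in> V"
      moreover have "{x\<in>D. h x \<in> S \<inter> T} = {x\<in>D. h x \<in> S} \<inter> {x\<in>D. h x \<in> T}"
        by blast
      ultimately show "S \<inter> T \<in> V"
        unfolding V_def using int by auto
    next
      fix S assume "S \<subseteq> B"
      moreover have "{x\<in>D. h x \<in> B - S} = D - {x\<in>D. h x \<in> S}"
        using hB by blast
      ultimately show "S \<in> V \<or> B - S \<in> V"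
        unfolding V_def using ultra[of "{x\<in>D. h x \<in> S}"] by auto
    qed
  next
    fix b assume "b \<in> B"
    \<comment> \<open>Points of \<open>C\<close> in the fibre over \<open>b\<close> lie outside
      \<open>A b\<close>, so a fibre in \<open>U\<close> would meet \<open>C\<close> and
      \<open>A b\<close> in the empty set.\<close>
    show "{b} \<notin> V"
    proof
      assume "{b} \<in> V"
      then have "{x\<in>D. h x \<in> {b}} \<inter> C \<inter> A b \<in> U"
        unfolding V_def using int CU A(1)[OF \<open>b \<in> B\<close>] by blast
      moreover have "{x\<in>D. h x \<in> {b}} \<inter> C \<inter> A b = {}"
        using hC by blast
      ultimately show False
        using empty by simp
    qed
  next
    fix \<F> assume \<F>: "\<F> \<subseteq> V \<and> \<F> \<noteq> {} \<and> |\<F>| <o |B|"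
    then have "|\<F>| \<le>o |B|"
      using ordLess_imp_ordLeq by blast
    \<comment> \<open>\<open>minimal\<close> speaks of index sets inside \<open>D\<close>, so the
      family is reindexed by its image under an injection into \<open>B\<close>.\<close>
    then obtain g where g: "inj_on g \<F>" "g ` \<F> \<subseteq> B"
      using card_of_ordLeq by metis
    have small: "|g ` \<F>| <o |B|"
      using \<F> card_of_image ordLeq_ordLess_trans by blast
    let ?P = "\<lambda>b. {x\<in>D. h x \<in> the_inv_into \<F> g b}"
    have inv: "the_inv_into \<F> g (g S) = S" if "S \<in> \<F>" for S
      using g(1) that by (rule the_inv_into_f_f)
    have "?P b \<in> U" if "b \<in> g ` \<F>" for b
    proof -
      obtain S where S: "S \<in> \<F>" "b = g S"
        using \<open>b \<in> g ` \<F>\<close> by blast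
      then show ?thesis
        using \<F> inv unfolding V_def by auto
    qed
    moreover have "g ` \<F> \<subseteq> D" "g ` \<F> \<noteq> {}"
      using \<F> g(2) BD(1) by auto
    ultimately have "(\<Inter>b\<in>g ` \<F>. ?P b) \<in> U"
      by (intro minimal) (use small in auto)
    moreover have "(\<Inter>b\<in>g ` \<F>. ?P b) \<subseteq> {x\<in>D. h x \<in> \<Inter>\<F>}"
    proof
      fix x assume x: "x \<in> (\<Inter>b\<in>g ` \<F>. ?P b)"
      have "x \<in> D \<and> h x \<in> S" if "S \<in> \<F>" for S
      proof -
        have "x \<in> ?P (g S)"
          using x that by blast
        then show ?thesis
          by (simp add: inv[OF that])
      qed
      then show "x \<in> {x\<in>D. h x \<in> \<Inter>\<F>}"
        using \<F> by blast
    qed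
    ultimately have "{x\<in>D. h x \<in> \<Inter>\<F>} \<in> U"
      using up by (metis (no_types, lifting) mem_Collect_eq subsetI)
    moreover have "\<Inter>\<F> \<subseteq> B"
      using \<F> unfolding V_def by blast
    ultimately show "\<Inter>\<F> \<in> V"
      unfolding V_def by simp
  qed
  then have "|D| <o |B|"
    using below unfolding below_first_measurable_def by blast
  then show False
    using card_of_mono1[OF BD(1)] not_ordLess_ordLeq by blast
qed

text \<open>
  If no finite set of coordinates isolates a point, then the sets \<open>A\<close> whose characteristic
  function has the value 1 under \<open>v\<close> form a nonprincipal countably complete ultrafilter.
\<close>
lemma finitely_many_coordinates_isolate:
  fixes D :: "'a set" and v :: "('a \<Rightarrow> nat) \<Rightarrow> nat"
  assumes below: "below_first_measurable |D|"
  shows "\<exists>F. finite F \<and> F \<subseteq> (D \<rightarrow>\<^sub>E UNIV) \<and>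
    (\<forall>x\<in>D. \<forall>y\<in>D. (\<forall>f\<in>F. f x = v f) \<longrightarrow> (\<forall>f\<in>F. f y = v f) \<longrightarrow> x = y)"
proof (rule ccontr)
  define isolates where "isolates F \<longleftrightarrow>
    (\<forall>x\<in>D. \<forall>y\<in>D. (\<forall>f\<in>F. f x = v f) \<longrightarrow> (\<forall>f\<in>F. f y = v f) \<longrightarrow> x = y)" for F
  assume "\<not> ?thesis"
  then have no: "\<not> isolates F" if "finite F" "F \<subseteq> D \<rightarrow>\<^sub>E UNIV" for F
    using that unfolding isolates_def by simp
  \<comment> \<open>Failure to isolate supplies points matching \<open>v\<close> on
    \<open>F\<close>, so \<open>v\<close> is finitely realized in \<open>D\<close>.\<close>
  have meet: "\<exists>x\<in>D. \<forall>f\<in>F. f x = v f" if "finite F" "F \<subseteq> D \<rightarrow>\<^sub>E UNIV" for F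
    using no[OF that] unfolding isolates_def by blast
  define chi :: "'a set \<Rightarrow> 'a \<Rightarrow> nat" where "chi A = (\<lambda>x\<in>D. if x \<in> A then 1 else 0)" for A
  have chi_ext: "chi A \<in> D \<rightarrow>\<^sub>E UNIV" for A
    unfolding chi_def by auto
  have chi_eq: "chi A x = (if x \<in> A then 1 else 0)" if "x \<in> D" for A x
    using that unfolding chi_def by simp
  define U where "U = {A. A \<subseteq> D \<and> v (chi A) = 1}"
  \<comment> \<open>One point realizes \<open>v\<close> at \<open>f\<close> and at three
    characteristic functions. Membership of three sets in \<open>U\<close> thus becomes membership
    of this point in them, which yields the ultrafilter axioms.\<close>
  have val: "\<exists>x\<in>D. f x = v f \<and> (x \<in> A \<longleftrightarrow> v (chi A) = 1) \<and> (x \<in> B \<longleftrightarrow> v (chi B) = 1)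
      \<and> (x \<in> C \<longleftrightarrow> v (chi C) = 1)"
    if f: "f \<in> D \<rightarrow>\<^sub>E UNIV" for f A B C
  proof -
    obtain x where x: "x \<in> D" "\<forall>f\<in>{f, chi A, chi B, chi C}. f x = v f"
      using meet[of "{f, chi A, chi B, chi C}"] f chi_ext by auto
    then have "v f = f x" "v (chi A) = chi A x" "v (chi B) = chi B x" "v (chi C) = chi C x"
      by simp_all
    then show ?thesis
      using x(1) by (intro bexI[of _ x]) (simp_all add: chi_eq)
  qed
  note val' = val[OF chi_ext]
  have "ultrafilter_on D U"
    unfolding ultrafilter_on_def
  proof (intro conjI ballI allI impI)
    show "U \<subseteq> Pow D"
      unfolding U_def by blast
    show "D \<in> U"
      using val'[of D D D D] unfolding U_def by blast
    show "{} \<notin> U"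
      using val'[of D "{}" D D] unfolding U_def by blast
  next
    fix S T assume "S \<in> U" "S \<subseteq> T \<and> T \<subseteq> D"
    then show "T \<in> U"
      using val'[of D S T D] unfolding U_def by blast
  next
    fix S T assume "S \<in> U" "T \<in> U"
    then show "S \<inter> T \<in> U"
      using val'[of D S T "S \<inter> T"] unfolding U_def by blast
  next
    fix S assume "S \<subseteq> D"
    then show "S \<in> U \<or> D - S \<in> U"
      using val'[of D S "D - S" D] unfolding U_def by blast
  qed
  moreover have "(\<Inter>n. A n) \<in> U" if A: "\<And>n. A n \<in> U" for A :: "nat \<Rightarrow> 'a set"
  proof (rule ccontr)
    assume notin: "(\<Inter>n. A n) \<notin> U"
    have sub: "(\<Inter>n. A n) \<subseteq> D"
      using A unfolding U_def by blast
    \<comment> \<open>The value 0 is reserved for the intersection, while \<open>Suc n\<close> names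
      a set \<open>A n\<close> omitting the point. A point realizing \<open>v\<close> at
      \<open>f\<close> would put the intersection into \<open>U\<close> in the first case and some
      \<open>A n\<close> outside \<open>U\<close> in the second.\<close>
    define f where "f = (\<lambda>x\<in>D. if x \<in> (\<Inter>n. A n) then 0 else Suc (SOME n. x \<notin> A n))"
    have f: "f \<in> D \<rightarrow>\<^sub>E UNIV"
      unfolding f_def by auto
    have f_out: "x \<notin> A n" if "x \<in> D" "f x = Suc n" for x n
    proof -
      have "x \<notin> (\<Inter>n. A n)" "n = (SOME n. x \<notin> A n)"
        using that by (auto simp: f_def split: if_splits)
      then show ?thesis
        using someI_ex[of "\<lambda>n. x \<notin> A n"] by blast
    qed
    have f_in: "x \<in> (\<Inter>n. A n)" if "x \<in> D" "f x = 0" for x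
      using that by (simp add: f_def split: if_splits)
    show False
    proof (cases "v f")
      case 0
      then show False
        using val[OF f, of "\<Inter>n. A n" D D] f_in notin sub unfolding U_def by auto
    next
      case (Suc n)
      then show False
        using val[OF f, of "A n" D D] f_out[of _ n] A[of n] unfolding U_def by auto
    qed
  qed
  ultimately obtain x where x: "x \<in> D" "{x} \<in> U"
    using countably_complete_ultrafilter_principal[OF below] by blast
  have unique: "y = x" if "y \<in> D" "chi {x} y = v (chi {x})" for y
  proof (rule ccontr)
    assume "y \<noteq> x"
    then have "chi {x} y = 0"
      using chi_eq[OF that(1), of "{x}"] by simp
    then show False
      using that(2) x(2) unfolding U_def by simp
  qed
  \<comment> \<open>As \<open>v (chi {x}) = 1\<close>, this single coordinate already isolates
    \<open>x\<close>.\<close>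
  have "isolates {chi {x}}"
    unfolding isolates_def
  proof (intro ballI impI)
    fix y z
    assume "y \<in> D" "z \<in> D" "\<forall>f\<in>{chi {x}}. f y = v f" "\<forall>f\<in>{chi {x}}. f z = v f"
    then have "y = x" "z = x"
      by (auto intro: unique)
    then show "y = z"
      by simp
  qed
  then show False
    using no[of "{chi {x}}"] chi_ext by simp
qed

section \<open>Closed discrete sets in \<open>X\<close> and in its powers\<close>

text \<open>The partial unions \<open>W m\<close> of a countable cover without finite subcover
  increase and never exhaust the space. Terms are chosen so that \<open>a i\<close> lies outside
  \<open>W (e i)\<close> but inside every later \<open>W (e j)\<close>. A neighbourhood
  \<open>W (e j)\<close> of a point then contains only finitely many terms, and T1 allows deleting
  those different from the point.\<close>

lemma closed_discrete_sequence_exists: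
  fixes X :: "'a topology"
  assumes t1: "t1_space X" and "\<not> countably_compact_space X"
  obtains a :: "nat \<Rightarrow> 'a" where "inj a" "range a \<subseteq> topspace X"
    "\<And>p. p \<in> topspace X \<Longrightarrow> \<exists>V. openin X V \<and> p \<in> V \<and> (\<forall>m n. a m \<in> V \<longrightarrow> a n \<in> V \<longrightarrow> m = n)"
proof -
  obtain \<U> where cover: "(countable \<U> \<and> (\<forall>U\<in>\<U>. openin X U) \<and> \<Union>\<U> = topspace X) \<and>
      \<not> (\<exists>\<F>. finite \<F> \<and> \<F> \<subseteq> \<U> \<and> \<Union>\<F> = topspace X)"
    using assms(2)[unfolded countably_compact_space_def not_all not_imp] by (rule exE)
  then have nofin: "\<Union>\<F> \<noteq> topspace X" if "finite \<F>" "\<F> \<subseteq> \<U>" for \<F>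
    using that by simp
  have \<U>: "countable \<U>" "\<And>u. u \<in> \<U> \<Longrightarrow> openin X u" "\<Union>\<U> = topspace X"
    using cover by simp_all
  have "\<U> \<noteq> {}"
    using nofin[of "{}"] \<U>(3) by auto
  define u where "u = from_nat_into \<U>"
  have range_u: "range u = \<U>"
    unfolding u_def using \<U>(1) \<open>\<U> \<noteq> {}\<close> by (rule range_from_nat_into[rotated])
  define W where "W m = (\<Union>k<m. u k)" for m :: nat
  have W_open: "openin X (W m)" for m
    unfolding W_def using \<U>(2) range_u by blast
  have W_mono: "W m \<subseteq> W n" if "m \<le> n" for m n
    unfolding W_def using that by (intro UN_mono) auto
  have W_cover: "\<exists>m. p \<in> W m" if p: "p \<in> topspace X" for p
  proof -
    obtain k where "p \<in> u k"
      using p \<U>(3) range_u by blast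
    then show ?thesis
      unfolding W_def by blast
  qed
  have "W m \<noteq> topspace X" for m
    unfolding W_def using nofin[of "u ` {..<m}"] range_u by blast
  then have "\<exists>x. x \<in> topspace X - W m" for m
    using openin_subset[OF W_open[of m]] by blast
  then obtain x where x: "\<And>m. x m \<in> topspace X" "\<And>m. x m \<notin> W m"
    by (metis Diff_iff)
  obtain r where r: "\<And>m. x m \<in> W (r m)"
    using W_cover[OF x(1)] by metis
  have r_gt: "m < r m" for m
    using r[of m] x(2)[of m] W_mono[of "r m" m] by (meson not_le_imp_less subsetD)
  define e where "e i = (r ^^ i) 0" for i
  have e_Suc: "e (Suc i) = r (e i)" for i
    unfolding e_def by simp
  have e_mono: "strict_mono e"
    using r_gt by (simp add: strict_mono_Suc_iff e_Suc)
  define a where "a i = x (e i)" for i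
  have a_in: "a i \<in> W (e j)" if "i < j" for i j
  proof -
    have "e (Suc i) \<le> e j"
      using that e_mono by (simp add: strict_mono_less_eq)
    then show ?thesis
      using r[of "e i"] W_mono unfolding a_def e_Suc by blast
  qed
  have a_notin: "a j \<notin> W (e i)" if "i \<le> j" for i j
  proof -
    have "e i \<le> e j"
      using that e_mono by (simp add: strict_mono_less_eq)
    then show ?thesis
      using x(2)[of "e j"] W_mono unfolding a_def by blast
  qed
  have "a i \<noteq> a j" if "i < j" for i j
    using a_in[OF that] a_notin[of j j] by auto
  then have inj: "inj a"
    by (metis injI linorder_neqE_nat)
  moreover have range: "range a \<subseteq> topspace X"
    unfolding a_def using x(1) by blast
  moreover have "\<exists>V. openin X V \<and> p \<in> V \<and> (\<forall>m n. a m \<in> V \<longrightarrow> a n \<in> V \<longrightarrow> m = n)"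
    if p: "p \<in> topspace X" for p
  proof -
    obtain j where "p \<in> W j"
      using W_cover[OF p] by blast
    moreover have "j \<le> e j"
      using e_mono by (rule strict_mono_imp_increasing)
    ultimately have pj: "p \<in> W (e j)"
      using W_mono by blast
    define V where "V = W (e j) - (a ` {..<j} - {p})"
    have "finite (a ` {..<j} - {p})" "a ` {..<j} - {p} \<subseteq> topspace X"
      using range by auto
    then have "closedin X (a ` {..<j} - {p})"
      using t1 unfolding t1_space_closedin_finite by blast
    then have "openin X V"
      unfolding V_def using W_open by (intro openin_diff)
    moreover have "a n = p" if "a n \<in> V" for n
    proof -
      have "n < j"
        using that a_notin[of j n] unfolding V_def by force
      then show ?thesis
        using that unfolding V_def by blast
    qed
    then have "\<forall>m n. a m \<in> V \<longrightarrow> a n \<in> V \<longrightarrow> m = n"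
      using inj by (metis injD)
    ultimately show ?thesis
      using pj unfolding V_def by blast
  qed
  ultimately show thesis
    using that by blast
qed

text \<open>Near a limit point \<open>p\<close> there would be exactly one point \<open>y\<close> of
  \<open>S\<close>, different from \<open>p\<close>; T1 lets \<open>y\<close> be deleted from the
  neighbourhood, a contradiction. An empty derived set gives closedness and discreteness at
  once.\<close>

lemma closed_discrete_if_locally_subsingleton:
  assumes "t1_space Y" "S \<subseteq> topspace Y"
    and loc: "\<And>p. p \<in> topspace Y \<Longrightarrow>
      \<exists>N. openin Y N \<and> p \<in> N \<and> (\<forall>s\<in>S. \<forall>t\<in>S. s \<in> N \<longrightarrow> t \<in> N \<longrightarrow> s = t)"
  shows "closedin Y S" and "subtopology Y S = discrete_topology S"
proof -
  have empty: "Y derived_set_of S = {}"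
  proof (rule ccontr)
    assume "Y derived_set_of S \<noteq> {}"
    then obtain p where p: "p \<in> topspace Y"
      and lim: "\<And>T. p \<in> T \<Longrightarrow> openin Y T \<Longrightarrow> \<exists>y. y \<noteq> p \<and> y \<in> S \<and> y \<in> T"
      unfolding in_derived_set_of ex_in_conv[symmetric] by blast
    obtain N where N: "openin Y N" "p \<in> N" "\<forall>s\<in>S. \<forall>t\<in>S. s \<in> N \<longrightarrow> t \<in> N \<longrightarrow> s = t"
      using loc[OF p] by blast
    obtain y where y: "y \<noteq> p" "y \<in> S" "y \<in> N"
      using lim[OF N(2,1)] by blast
    have "openin Y (N - {y})"
      using assms(1) N(1) by (simp add: t1_space_openin_delete_alt)
    then obtain z where "z \<in> S" "z \<in> N - {y}"
      using lim[of "N - {y}"] N(2) y(1) by auto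
    then show False
      using N(3) y by blast
  qed
  then show "closedin Y S"
    using assms(2) by (simp add: closedin_contains_derived_set)
  show "subtopology Y S = discrete_topology S"
    using empty assms(2) discrete_topology_unique_derived_set[of S "subtopology Y S"]
    by (auto simp: derived_set_of_subtopology)
qed

lemma finite_coordinate_box_open:
  assumes "finite K" "K \<subseteq> I" and "\<And>i. i \<in> K \<Longrightarrow> openin X (V i)"
  shows "openin (product_topology (\<lambda>_. X) I) {q \<in> I \<rightarrow>\<^sub>E topspace X. \<forall>i\<in>K. q i \<in> V i}"
proof -
  define V' where "V' i = (if i \<in> K then V i else topspace X)" for i
  have "{q \<in> I \<rightarrow>\<^sub>E topspace X. \<forall>i\<in>K. q i \<in> V i} = Pi\<^sub>E I V'"
  proof (intro equalityI subsetI)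
    fix q assume "q \<in> {q \<in> I \<rightarrow>\<^sub>E topspace X. \<forall>i\<in>K. q i \<in> V i}"
    then show "q \<in> Pi\<^sub>E I V'"
      by (auto simp: V'_def PiE_iff)
  next
    fix q assume q: "q \<in> Pi\<^sub>E I V'"
    have "V' i \<subseteq> topspace X" for i
      using openin_subset[OF assms(3)] by (simp add: V'_def)
    then have "q \<in> I \<rightarrow>\<^sub>E topspace X"
      using q PiE_mono[of I V' "\<lambda>_. topspace X"] by blast
    moreover have "q i \<in> V i" if "i \<in> K" for i
      using PiE_mem[OF q, of i] that assms(2) by (auto simp: V'_def)
    ultimately show "q \<in> {q \<in> I \<rightarrow>\<^sub>E topspace X. \<forall>i\<in>K. q i \<in> V i}"
      by blast
  qed
  moreover have "finite {i \<in> I. V' i \<noteq> topspace X}"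
    using assms(1) by (rule finite_subset[rotated]) (auto simp: V'_def)
  moreover have "\<forall>i\<in>I. openin X (V' i)"
    using assms(3) by (auto simp: V'_def)
  ultimately show ?thesis
    by (simp add: openin_PiE_gen)
qed

section \<open>Separating finitely many functions, and the size of the index set\<close>

text \<open>One separating point is taken for each pair of distinct functions; extensionality places
  it in \<open>D\<close>. With a list, the pattern \<open>map f ss\<close> is a finite sequence of
  numbers, hence drawn from a countable set.\<close>

lemma finite_extensional_functions_separated:
  assumes "finite G" "G \<subseteq> D \<rightarrow>\<^sub>E UNIV"
  obtains ss where "set ss \<subseteq> D" "inj_on (\<lambda>f. map f ss) G"
proof -
  have "\<exists>x\<in>D. f x \<noteq> g x" if "f \<in> G" "g \<in> G" "f \<noteq> g" for f g
    using that assms(2) by (meson PiE_ext subsetD)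
  then obtain s where s: "\<And>f g. f \<in> G \<Longrightarrow> g \<in> G \<Longrightarrow> f \<noteq> g \<Longrightarrow> s f g \<in> D \<and> f (s f g) \<noteq> g (s f g)"
    by metis
  define S where "S = (\<lambda>(f, g). s f g) ` {(f, g) \<in> G \<times> G. f \<noteq> g}"
  have "finite S"
    unfolding S_def using assms(1) by (auto intro: finite_subset[of _ "G \<times> G"])
  then obtain ss where ss: "set ss = S"
    using finite_list by blast
  have "set ss \<subseteq> D"
    unfolding ss S_def using s by auto
  moreover have "f = g" if "f \<in> G" "g \<in> G" "map f ss = map g ss" for f g
  proof (rule ccontr)
    assume "f \<noteq> g"
    then have "s f g \<in> set ss"
      unfolding ss S_def using that by force
    then have "f (s f g) = g (s f g)"
      using that(3) by (metis map_eq_conv)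
    then show False
      using s[of f g] that \<open>f \<noteq> g\<close> by blast
  qed
  then have "inj_on (\<lambda>f. map f ss) G"
    by (rule inj_onI)
  ultimately show thesis
    using that by blast
qed

text \<open>The cardinal \<open>natLeq ^c |D|\<close> is squeezed between \<open>ctwo ^c |D|\<close>
  and \<open>(ctwo ^c natLeq) ^c |D|\<close>, where the exponents multiply and \<open>natLeq\<close>
  is absorbed by \<open>|D|\<close>. This identifies the given index set with countably many blocks
  of functions.\<close>

lemma card_of_nat_times_functions:
  fixes D :: "'a set"
  assumes "infinite D"
  shows "|(UNIV :: nat set) \<times> (D \<rightarrow>\<^sub>E (UNIV :: nat set))| =o ctwo ^c |D|"
proof -
  have inf: "Cinfinite |D|"
    using assms by (simp add: cinfinite_def Field_card_of card_of_card_order_on)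
  have natLeq_le: "natLeq \<le>o |D|"
    using assms infinite_iff_natLeq_ordLeq by blast
  have ctwo_le: "ctwo \<le>o natLeq"
    by (rule ordLess_imp_ordLeq[OF ctwo_ordLess_natLeq])
  have "D \<rightarrow>\<^sub>E (UNIV :: nat set) = Func D UNIV"
    by (auto simp: Func_def PiE_iff extensional_def)
  then have eq: "|D \<rightarrow>\<^sub>E (UNIV :: nat set)| = natLeq ^c |D|"
    by (simp add: cexp_def Field_card_of Field_natLeq)
  have "(ctwo ^c natLeq) ^c |D| =o ctwo ^c (natLeq *c |D| )"
    by (rule cexp_cprod[OF Card_order_ctwo])
  moreover have "ctwo ^c (natLeq *c |D| ) =o ctwo ^c |D|"
    by (intro cexp_cong2 cprod_infinite2' inf natLeq_le Cinfinite_Cnotzero natLeq_Cinfinite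
        Card_order_ctwo Card_order_cprod)
  moreover have "natLeq ^c |D| \<le>o (ctwo ^c natLeq) ^c |D|"
    by (intro cexp_mono1 ordLess_imp_ordLeq ordLess_ctwo_cexp natLeq_Card_order card_of_Card_order)
  ultimately have "natLeq ^c |D| \<le>o ctwo ^c |D|"
    by (meson ordLeq_ordIso_trans)
  moreover have "ctwo ^c |D| \<le>o natLeq ^c |D|"
    using ctwo_le by (rule cexp_mono1) (rule card_of_Card_order)
  ultimately have exp: "natLeq ^c |D| =o ctwo ^c |D|"
    by (simp add: ordIso_iff_ordLeq)
  have "Cinfinite (natLeq ^c |D| )"
    by (rule Cinfinite_cexp[OF ctwo_le inf])
  moreover have "natLeq \<le>o natLeq ^c |D|"
    by (rule ordLeq_transitive[OF natLeq_le ordLeq_cexp2[OF ctwo_le card_of_Card_order]])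
  ultimately have "natLeq *c (natLeq ^c |D| ) =o natLeq ^c |D|"
    by (intro cprod_infinite2' Cinfinite_Cnotzero natLeq_Cinfinite)
  moreover have "|(UNIV :: nat set) \<times> (D \<rightarrow>\<^sub>E (UNIV :: nat set))| = natLeq *c (natLeq ^c |D| )"
    unfolding cprod_def eq[symmetric] by (simp add: Field_card_of Field_natLeq)
  ultimately show ?thesis
    using exp by (metis ordIso_transitive)
qed

section \<open>The dense union of closed discrete families in the power\<close>

theorem corollary3p9:
  fixes X :: "'a topology" and I :: "'i set"
  assumes "t1_space X"
    and "\<not> countably_compact_space X"
    and "below_first_measurable (top_density X)"
    and "|I| =o ctwo ^c top_density X"
  shows "e_separable (product_topology (\<lambda>_. X) I)"
proof -
  let ?Y = "product_topology (\<lambda>_. X) I"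
  obtain D where D: "dense_in X D" and density: "top_density X = |D|"
    using top_density_minimal(1) by blast
  have D_sub: "D \<subseteq> topspace X" and D_closure: "X closure_of D = topspace X"
    using D unfolding dense_in_def by blast+
  have below: "below_first_measurable |D|"
    using assms(3) density by simp
  obtain a :: "nat \<Rightarrow> 'a" where a: "inj a" "range a \<subseteq> topspace X"
    and a_loc: "\<And>p. p \<in> topspace X \<Longrightarrow>
      \<exists>V. openin X V \<and> p \<in> V \<and> (\<forall>m n. a m \<in> V \<longrightarrow> a n \<in> V \<longrightarrow> m = n)"
    by (rule closed_discrete_sequence_exists[OF assms(1,2)]) (rule that)
  \<comment> \<open>A finite dense set would be closed, hence the whole space, which contains an
    injective sequence.\<close>
  have "infinite D"
  proof
    assume "finite D"
    then have "closedin X D"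
      using assms(1) D_sub by (simp add: t1_space_closedin_finite)
    then have "D = topspace X"
      using D_closure closure_of_closedin by metis
    then show False
      using \<open>finite D\<close> a by (metis finite_subset infinite_UNIV_nat finite_imageD)
  qed
  have "|I| =o |(UNIV :: nat set) \<times> (D \<rightarrow>\<^sub>E (UNIV :: nat set))|"
    using assms(4) card_of_nat_times_functions[OF \<open>infinite D\<close>] density
    by (metis ordIso_symmetric ordIso_transitive)
  then obtain \<phi> :: "'i \<Rightarrow> nat \<times> ('a \<Rightarrow> nat)" where \<phi>: "bij_betw \<phi> I (UNIV \<times> (D \<rightarrow>\<^sub>E (UNIV :: nat set)))"
    using card_of_ordIso by blast
  have \<phi>_D: "snd (\<phi> i) \<in> D \<rightarrow>\<^sub>E UNIV" if "i \<in> I" for i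
    using bij_betwE[OF \<phi>] that by (auto simp: mem_Times_iff)

  \<comment> \<open>The first \<open>k\<close> entries of \<open>xs\<close> are the separating
    points, the others the values; a key is a block number with a pattern at those points. The
    default \<open>a 0\<close> keeps failed lookups in the space.\<close>
  define table :: "nat \<Rightarrow> (nat \<times> nat list) list \<Rightarrow> 'a list \<Rightarrow> nat \<Rightarrow> ('a \<Rightarrow> nat) \<Rightarrow> 'a" where
    "table k keys xs m f =
      (case map_of (zip keys (drop k xs)) (m, map f (take k xs)) of Some d \<Rightarrow> d | None \<Rightarrow> a 0)"
    for k keys xs m f
  \<comment> \<open>Block \<open>n + j\<close> records the entry \<open>xs ! j\<close> through the
    closed discrete copy of \<open>D\<close>; blocks after the last entry are padded.\<close>
  define coord :: "nat \<Rightarrow> nat \<Rightarrow> (nat \<times> nat list) list \<Rightarrow> 'a list \<Rightarrow> nat \<Rightarrow> ('a \<Rightarrow> nat) \<Rightarrow> 'a" where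
    "coord n k keys xs m f =
      (if m < n then table k keys xs m f
       else if m < n + length xs then a (f (xs ! (m - n))) else a 0)"
    for n k keys xs m f
  define point :: "nat \<Rightarrow> nat \<Rightarrow> (nat \<times> nat list) list \<Rightarrow> 'a list \<Rightarrow> 'i \<Rightarrow> 'a" where
    "point n k keys xs = (\<lambda>i\<in>I. coord n k keys xs (fst (\<phi> i)) (snd (\<phi> i)))"
    for n k keys xs
  \<comment> \<open>The parameters \<open>n\<close>, \<open>k\<close>, \<open>keys\<close> have
    countable types; only \<open>xs\<close> may range over an uncountable set. Its fixed length
    determines which blocks record entries.\<close>
  define family where
    "family n k keys = point n k keys ` {xs. set xs \<subseteq> D \<and> length xs = k + length keys}"
    for n k keys

  have point_in: "point n k keys xs \<in> topspace ?Y" if "set xs \<subseteq> D" for n k keys xs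
  proof -
    have "table k keys xs m f \<in> topspace X" for m f
    proof (cases "map_of (zip keys (drop k xs)) (m, map f (take k xs))")
      case None
      then show ?thesis
        using a(2) by (auto simp: table_def)
    next
      case (Some d)
      then have "d \<in> set (drop k xs)"
        by (meson map_of_SomeD set_zip_rightD)
      then show ?thesis
        using Some that D_sub by (auto simp: table_def dest: in_set_dropD)
    qed
    then show ?thesis
      using range_subsetD[OF a(2)] by (auto simp: point_def coord_def)
  qed

  have closed_discrete: "closedin ?Y (family n k keys) \<and>
      subtopology ?Y (family n k keys) = discrete_topology (family n k keys)" for n k keys
  proof -
    have t1: "t1_space ?Y"
      using assms(1) by (simp add: t1_space_product_topology)
    have sub: "family n k keys \<subseteq> topspace ?Y"
      unfolding family_def using point_in by blast
    have loc: "\<exists>N. openin ?Y N \<and> p \<in> N \<and>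
        (\<forall>s\<in>family n k keys. \<forall>t\<in>family n k keys. s \<in> N \<longrightarrow> t \<in> N \<longrightarrow> s = t)"
      if p: "p \<in> topspace ?Y" for p
    proof -
      define l where "l = k + length keys"
      define ix where "ix m f = inv_into I \<phi> (m, f)" for m f
      have ix: "ix m f \<in> I" "\<phi> (ix m f) = (m, f)" if "f \<in> D \<rightarrow>\<^sub>E UNIV" for m f
        using that \<phi> unfolding ix_def
        by (auto simp: bij_betw_def inv_into_into f_inv_into_f)
      have p_in: "p i \<in> topspace X" if "i \<in> I" for i
        using p that by (auto simp: PiE_iff)
      have "\<forall>i\<in>I. \<exists>V. openin X V \<and> p i \<in> V \<and> (\<forall>m n. a m \<in> V \<longrightarrow> a n \<in> V \<longrightarrow> m = n)"
        by (intro ballI a_loc p_in)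
      from bchoice[OF this] obtain V where
        "\<forall>i\<in>I. openin X (V i) \<and> p i \<in> V i \<and> (\<forall>m n. a m \<in> V i \<longrightarrow> a n \<in> V i \<longrightarrow> m = n)"
        by (rule exE)
      then have V: "openin X (V i)" "p i \<in> V i"
        "a m \<in> V i \<Longrightarrow> a n \<in> V i \<Longrightarrow> m = n" if "i \<in> I" for i m n
        using that by blast+
      \<comment> \<open>\<open>V\<close> contains at most one term of the sequence at each
        coordinate, and \<open>v j f\<close> is its index. If there is none, the value is arbitrary,
        and for \<open>j < l\<close> no member of the family enters \<open>V\<close> there.\<close>
      define v where "v j f = (SOME c. a c \<in> V (ix (n + j) f))" for j f
      have v: "c = v j f" if "f \<in> D \<rightarrow>\<^sub>E UNIV" "a c \<in> V (ix (n + j) f)" for c j f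
        using V(3)[OF ix(1)[OF that(1)] that(2)] someI[of "\<lambda>c. a c \<in> V (ix (n + j) f)", OF that(2)]
        unfolding v_def by blast
      have "\<exists>F. \<forall>j. finite (F j) \<and> F j \<subseteq> D \<rightarrow>\<^sub>E UNIV \<and>
          (\<forall>x\<in>D. \<forall>y\<in>D. (\<forall>f\<in>F j. f x = v j f) \<longrightarrow> (\<forall>f\<in>F j. f y = v j f) \<longrightarrow> x = y)"
        by (intro choice allI finitely_many_coordinates_isolate below)
      then obtain F where F_all: "\<forall>j. finite (F j) \<and> F j \<subseteq> D \<rightarrow>\<^sub>E UNIV \<and>
          (\<forall>x\<in>D. \<forall>y\<in>D. (\<forall>f\<in>F j. f x = v j f) \<longrightarrow> (\<forall>f\<in>F j. f y = v j f) \<longrightarrow> x = y)"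
        by (rule exE)
      then have F: "finite (F j)" "F j \<subseteq> D \<rightarrow>\<^sub>E UNIV" for j
        by simp_all
      have F_isolates: "x = y"
        if "x \<in> D" "y \<in> D" "\<forall>f\<in>F j. f x = v j f" "\<forall>f\<in>F j. f y = v j f" for j x y
        using F_all[rule_format, of j] that by blast
      \<comment> \<open>Finitely many coordinates of block \<open>n + j\<close> pin down entry
        \<open>j\<close>, so finitely many pin down all of \<open>xs\<close>.\<close>
      define K where "K = (\<Union>j<l. ix (n + j) ` F j)"
      define N where "N = {q \<in> I \<rightarrow>\<^sub>E topspace X. \<forall>i\<in>K. q i \<in> V i}"
      have K: "finite K" "K \<subseteq> I"
        unfolding K_def using F(1,2) ix(1) by blast+
      have "openin ?Y N"
        unfolding N_def using K V(1) by (intro finite_coordinate_box_open) auto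
      moreover have "p \<in> N"
        unfolding N_def using p K(2) V(2) by auto
      moreover have determined: "f (xs ! j) = v j f"
        if "set xs \<subseteq> D" "length xs = l" "point n k keys xs \<in> N" "j < l" "f \<in> F j" for xs j f
      proof -
        have f: "f \<in> D \<rightarrow>\<^sub>E UNIV"
          using F(2) that by blast
        have "ix (n + j) f \<in> K"
          unfolding K_def using that by blast
        then have "point n k keys xs (ix (n + j) f) \<in> V (ix (n + j) f)"
          using that unfolding N_def by blast
        moreover have "point n k keys xs (ix (n + j) f) = a (f (xs ! j))"
          using that ix[OF f] by (simp add: point_def coord_def)
        ultimately show ?thesis
          using v[OF f] by simp
      qed
      have "xs = ys" if xs: "set xs \<subseteq> D" "length xs = l" "point n k keys xs \<in> N"
        and ys: "set ys \<subseteq> D" "length ys = l" "point n k keys ys \<in> N" for xs ys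
      proof (rule nth_equalityI)
        show "length xs = length ys"
          using xs ys by simp
        fix j assume "j < length xs"
        then have "j < l" "xs ! j \<in> D" "ys ! j \<in> D"
          using xs(1,2) ys(1,2) by auto
        then show "xs ! j = ys ! j"
          using determined[OF xs] determined[OF ys] by (intro F_isolates) auto
      qed
      then have "\<forall>s\<in>family n k keys. \<forall>t\<in>family n k keys. s \<in> N \<longrightarrow> t \<in> N \<longrightarrow> s = t"
        unfolding family_def l_def by blast
      ultimately show ?thesis
        by blast
    qed
    show ?thesis
      using closed_discrete_if_locally_subsingleton[OF t1 sub loc] by blast
  qed

  have dense: "dense_in ?Y (\<Union>(n, k, keys). family n k keys)"
  proof -
    have sub: "(\<Union>(n, k, keys). family n k keys) \<subseteq> topspace ?Y"
      unfolding family_def using point_in by blast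
    have "\<exists>n k keys xs. set xs \<subseteq> D \<and> length xs = k + length keys \<and> point n k keys xs \<in> T"
      if T: "openin ?Y T" "p \<in> T" for p T
    proof -
      obtain W where W: "finite {i \<in> I. W i \<noteq> topspace X}" "\<And>i. i \<in> I \<Longrightarrow> openin X (W i)"
        "p \<in> Pi\<^sub>E I W" "Pi\<^sub>E I W \<subseteq> T"
        using T unfolding openin_product_topology_alt by metis
      define K where "K = {i \<in> I. W i \<noteq> topspace X}"
      have K: "finite K" "K \<subseteq> I"
        unfolding K_def using W(1) by auto
      have "\<exists>d. d \<in> D \<and> d \<in> W i" if "i \<in> I" for i
      proof -
        have "p i \<in> W i"
          using W(3) that by (auto simp: PiE_iff)
        moreover have "p i \<in> X closure_of D"
          using D_closure calculation openin_subset[OF W(2)[OF that]] by blast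
        ultimately show ?thesis
          using W(2)[OF that] unfolding in_closure_of by blast
      qed
      then obtain d where d: "\<And>i. i \<in> I \<Longrightarrow> d i \<in> D \<and> d i \<in> W i"
        by metis
      \<comment> \<open>Keys and values follow the same enumeration of \<open>K\<close>, so zipping
        pairs each key with its own value.\<close>
      obtain es where es: "set es = K" "distinct es"
        using finite_distinct_list[OF K(1)] by blast
      have "finite ((snd \<circ> \<phi>) ` K)" "(snd \<circ> \<phi>) ` K \<subseteq> D \<rightarrow>\<^sub>E UNIV"
        using K \<phi>_D by auto
      then obtain ss where ss: "set ss \<subseteq> D" "inj_on (\<lambda>f. map f ss) ((snd \<circ> \<phi>) ` K)"
        by (rule finite_extensional_functions_separated) (rule that)
      define key where "key i = (fst (\<phi> i), map (snd (\<phi> i)) ss)" for i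
      \<comment> \<open>Distinct coordinates in one block differ in their function, which
        \<open>ss\<close> detects. Distinct keys make the lookup return the intended value.\<close>
      have key_inj: "inj_on key K"
      proof (rule inj_onI)
        fix i j assume ij: "i \<in> K" "j \<in> K" "key i = key j"
        then have "snd (\<phi> i) = snd (\<phi> j)"
          using inj_onD[OF ss(2), of "snd (\<phi> i)" "snd (\<phi> j)"] by (simp add: key_def)
        then have "\<phi> i = \<phi> j"
          using ij(3) by (simp add: key_def prod_eq_iff)
        then show "i = j"
          using ij K(2) \<phi> by (meson bij_betw_imp_inj_on inj_onD subsetD)
      qed
      define keys where "keys = map key es"
      define xs where "xs = ss @ map d es"
      \<comment> \<open>All blocks meeting \<open>K\<close> lie below \<open>n\<close>, so the
        recording blocks do not touch the constrained coordinates; inserting 0 covers empty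
        \<open>K\<close>.\<close>
      define n where "n = Suc (Max (insert 0 ((fst \<circ> \<phi>) ` K)))"
      have n: "fst (\<phi> i) < n" if "i \<in> K" for i
        unfolding n_def using K(1) that by (simp add: le_imp_less_Suc)
      have xs: "set xs \<subseteq> D" "length xs = length ss + length keys"
        unfolding xs_def keys_def using ss d es K(2) by auto
      have "point n (length ss) keys xs i \<in> W i" if i: "i \<in> I" for i
      proof (cases "i \<in> K")
        case True
        obtain c where "c < length es" "es ! c = i"
          using True es(1) by (metis in_set_conv_nth)
        moreover have "distinct keys"
          unfolding keys_def using es key_inj by (simp add: distinct_map)
        ultimately have "map_of (zip keys (map d es)) (key i) = Some (d i)"
          using map_of_zip_nth[of keys "map d es" c] by (simp add: keys_def)
        then show ?thesis
          using i n[OF True] d by (simp add: point_def coord_def table_def xs_def key_def)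
      next
        case False
        then show ?thesis
          using i point_in[OF xs(1), of n "length ss" keys] by (auto simp: K_def PiE_iff)
      qed
      then have "point n (length ss) keys xs \<in> Pi\<^sub>E I W"
        by (auto simp: point_def)
      then show ?thesis
        using xs W(4) by blast
    qed
    then have "?Y closure_of (\<Union>(n, k, keys). family n k keys) = topspace ?Y"
      unfolding dense_intersects_open family_def by fastforce
    then show ?thesis
      unfolding dense_in_def using sub by blast
  qed

  \<comment> \<open>\<open>from_nat\<close> is onto the countable type of parameter triples, so one
    sequence runs through all families.\<close>
  define E where "E c = (case from_nat c of (n, k, keys) \<Rightarrow> family n k keys)" for c :: nat
  have "range E = (\<lambda>(n, k, keys). family n k keys) ` range from_nat"
    unfolding E_def by (simp only: image_image)
  then have "(\<Union>c. E c) = (\<Union>(n, k, keys). family n k keys)"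
    by simp
  moreover have "closedin ?Y (E c) \<and> subtopology ?Y (E c) = discrete_topology (E c)" for c
    unfolding E_def using closed_discrete by (simp split: prod.split)
  ultimately show ?thesis
    unfolding e_separable_def using dense by metis
qed

end
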